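(* Let $s\in(1,\infty)$. For every $\bar u\in L^s(\Omega)$, \[ \partial^\infty q_{s,0}(\bar u)=\{\eta\in L^r(\Omega) : \{\eta\neq 0\}\subset\{\bar u=0\}\}. \]
   Context: $\Omega\subset\mathbb{R}^d$ is a Lebesgue-measurable set with positive and finite Lebesgue measure; $\boldsymbol{\lambda}$ denotes Lebesgue measure. For $s\in(1,\infty)$, $r\in(1,\infty)$ is given by $\frac1s+\frac1r=1$, and $L^r(\Omega)$ is identified with the dual of $L^s(\Omega)$. For measurable $u$, $\{u\neq0\}:=\{x\in\Omega : u(x)\neq 0\}$ and $\{u=0\}:=\{x\in\Omega : u(x)=0\}$; these sets are defined up to null sets and inclusions between them are understood up to null sets. The functional $q_{s,0}\colon L^s(\Omega)\to\mathbb{R}$ is $q_{s,0}(u):=\int_\Omega |u(x)|_0\,\mathrm{d}x=\boldsymbol{\lambda}(\{u\neq 0\})$, where $|y|_0:=0$ if $y=0$ and $|y|_0:=1$ for $y\in\mathbb{R}\setminus\{0\}$. The Fréchet subdifferential of $q_{s,0}$ at $u\in L^s(\Omega)$ is \[ \widehat{\partial} q_{s,0}(u):=\Bigl\{\eta\in L^r(\Omega) : \liminf_{\Vert h\Vert_s\searrow 0}\frac{q_{s,0}(u+h)-q_{s,0}(u)-\int_\Omega\eta(x)h(x)\,\mathrm{d}x}{\Vert h\Vert_s}\ge 0\Bigr\}, \] where the lower limit is over $h\in L^s(\Omega)\setminus\{0\}$ with $\Vert h\Vert_s\to 0$. The singular subdifferential $\partial^\infty q_{s,0}(\bar u)$ is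 the set of all $\eta\in L^r(\Omega)$ for which there exist sequences $\{u_k\}_{k\in\mathbb{N}}\subset L^s(\Omega)$, $\{t_k\}_{k\in\mathbb{N}}\subset(0,\infty)$ and $\{\eta_k\}_{k\in\mathbb{N}}\subset L^r(\Omega)$ such that $u_k\to\bar u$ in $L^s(\Omega)$, $q_{s,0}(u_k)\to q_{s,0}(\bar u)$, $t_k\to 0$, $t_k\eta_k\rightharpoonup\eta$ weakly in $L^r(\Omega)$, and $\eta_k\in\widehat{\partial} q_{s,0}(u_k)$ for all $k\in\mathbb{N}$. *)

theory Defs
  imports "HOL-Analysis.Analysis"
begin

text \<open>Elements of \<open>L\<^sup>p(\<Omega>)\<close> are represented by functions rather than by classes modulo equality
  almost everywhere. All notions below depend only on the class on \<open>\<Omega>\<close> of the functions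
  involved; values outside \<open>\<Omega>\<close> are irrelevant.\<close>

definition Lp_space :: "'a::euclidean_space set \<Rightarrow> real \<Rightarrow> ('a \<Rightarrow> real) set" where
  "Lp_space \<Omega> p = {u \<in> borel_measurable (lebesgue_on \<Omega>).
     integrable (lebesgue_on \<Omega>) (\<lambda>x. \<bar>u x\<bar> powr p)}"

definition Lp_norm :: "'a::euclidean_space set \<Rightarrow> real \<Rightarrow> ('a \<Rightarrow> real) \<Rightarrow> real" where
  "Lp_norm \<Omega> p u = (LINT x|lebesgue_on \<Omega>. \<bar>u x\<bar> powr p) powr (1 / p)"

definition Lp_tendsto ::
    "'a::euclidean_space set \<Rightarrow> real \<Rightarrow> (nat \<Rightarrow> 'a \<Rightarrow> real) \<Rightarrow> ('a \<Rightarrow> real) \<Rightarrow> bool" where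
  "Lp_tendsto \<Omega> p f g \<longleftrightarrow> (\<lambda>k. Lp_norm \<Omega> p (\<lambda>x. f k x - g x)) \<longlonglongrightarrow> 0"

text \<open>Bounded linear functionals on \<open>L\<^sup>p(\<Omega>)\<close>. Linearity and the bound make \<open>\<phi>\<close> agree on
  functions that are equal almost everywhere on \<open>\<Omega>\<close>.\<close>

definition Lp_dual :: "'a::euclidean_space set \<Rightarrow> real \<Rightarrow> (('a \<Rightarrow> real) \<Rightarrow> real) set" where
  "Lp_dual \<Omega> p = {\<phi>.
     (\<forall>f\<in>Lp_space \<Omega> p. \<forall>g\<in>Lp_space \<Omega> p. \<phi> (\<lambda>x. f x + g x) = \<phi> f + \<phi> g) \<and>
     (\<forall>c. \<forall>f\<in>Lp_space \<Omega> p. \<phi> (\<lambda>x. c * f x) = c * \<phi> f) \<and>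
     (\<exists>C. \<forall>f\<in>Lp_space \<Omega> p. \<bar>\<phi> f\<bar> \<le> C * Lp_norm \<Omega> p f)}"

definition Lp_weak_tendsto ::
    "'a::euclidean_space set \<Rightarrow> real \<Rightarrow> (nat \<Rightarrow> 'a \<Rightarrow> real) \<Rightarrow> ('a \<Rightarrow> real) \<Rightarrow> bool" where
  "Lp_weak_tendsto \<Omega> p f g \<longleftrightarrow> (\<forall>\<phi>\<in>Lp_dual \<Omega> p. (\<lambda>k. \<phi> (f k)) \<longlonglongrightarrow> \<phi> g)"

definition abs0 :: "real \<Rightarrow> real" where
  "abs0 y = (if y = 0 then 0 else 1)"

text \<open>The functional \<open>q\<^bsub>s,0\<^esub>\<close>; the exponent \<open>s\<close> only determines its domain.\<close>

definition q0 :: "'a::euclidean_space set \<Rightarrow> ('a \<Rightarrow> real) \<Rightarrow> real" where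
  "q0 \<Omega> u = (LINT x|lebesgue_on \<Omega>. abs0 (u x))"

text \<open>The filter of \<open>h \<in> L\<^sup>s(\<Omega>) \<setminus> {0}\<close> whose norm tends to 0: as \<^term>\<open>at_right 0\<close> forces the
  norm to be positive, \<open>h\<close> is nonzero as an element of \<open>L\<^sup>s(\<Omega>)\<close>.\<close>

definition Lp_at_zero :: "'a::euclidean_space set \<Rightarrow> real \<Rightarrow> ('a \<Rightarrow> real) filter" where
  "Lp_at_zero \<Omega> s = inf (filtercomap (Lp_norm \<Omega> s) (at_right 0)) (principal (Lp_space \<Omega> s))"

text \<open>In the following, \<open>r\<close> is meant to be the exponent conjugate to \<open>s\<close>.\<close>

definition frechet_subdiff_q0 ::
    "'a::euclidean_space set \<Rightarrow> real \<Rightarrow> real \<Rightarrow> ('a \<Rightarrow> real) \<Rightarrow> ('a \<Rightarrow> real) set" where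
  "frechet_subdiff_q0 \<Omega> s r u = {\<eta> \<in> Lp_space \<Omega> r.
     0 \<le> Liminf (Lp_at_zero \<Omega> s) (\<lambda>h.
       ereal ((q0 \<Omega> (\<lambda>x. u x + h x) - q0 \<Omega> u - (LINT x|lebesgue_on \<Omega>. \<eta> x * h x))
              / Lp_norm \<Omega> s h))}"

definition singular_subdiff_q0 ::
    "'a::euclidean_space set \<Rightarrow> real \<Rightarrow> real \<Rightarrow> ('a \<Rightarrow> real) \<Rightarrow> ('a \<Rightarrow> real) set" where
  "singular_subdiff_q0 \<Omega> s r ubar = {\<eta> \<in> Lp_space \<Omega> r.
     \<exists>(u :: nat \<Rightarrow> 'a \<Rightarrow> real) (t :: nat \<Rightarrow> real) (\<xi> :: nat \<Rightarrow> 'a \<Rightarrow> real).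
       (\<forall>k. u k \<in> Lp_space \<Omega> s) \<and> (\<forall>k. 0 < t k) \<and> (\<forall>k. \<xi> k \<in> Lp_space \<Omega> r) \<and>
       Lp_tendsto \<Omega> s u ubar \<and>
       (\<lambda>k. q0 \<Omega> (u k)) \<longlonglongrightarrow> q0 \<Omega> ubar \<and>
       t \<longlonglongrightarrow> 0 \<and>
       Lp_weak_tendsto \<Omega> r (\<lambda>k x. t k * \<xi> k x) \<eta> \<and>
       (\<forall>k. \<xi> k \<in> frechet_subdiff_q0 \<Omega> s r (u k))}"

end

theory Submission
  imports Defs
begin

text \<open>A Frechet subgradient at \<open>u\<close> vanishes on \<open>{u \<noteq> 0}\<close>. If \<open>u\<^sub>k \<rightarrow> ubar\<close> in \<open>L\<^sup>s\<close>, then along a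
  subsequence almost every point of \<open>{ubar \<noteq> 0}\<close> eventually lies in \<open>{u\<^sub>k \<noteq> 0}\<close>, so testing the
  weak limit with \<open>sgn \<eta>\<close> restricted to \<open>{u\<^sub>k \<noteq> 0 for all k \<ge> n}\<close> forces \<open>\<eta> = 0\<close> there, without
  any bound on the weakly convergent sequence. Conversely, functions bounded away from 0 on their
  support have every \<open>\<eta>\<close> that vanishes on this support as a Frechet subgradient; hence if \<open>\<eta>\<close>
  vanishes on \<open>{ubar \<noteq> 0}\<close>, the truncations \<open>u\<^sub>k = ubar 1\<^bsub>{\<bar>ubar\<bar> \<ge> 1/k}\<^esub>\<close> with \<open>t\<^sub>k = 1/k\<close> and
  \<open>\<xi>\<^sub>k = k \<eta>\<close> work, because \<open>t\<^sub>k \<xi>\<^sub>k\<close> is constantly \<open>\<eta>\<close>.\<close>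

section \<open>The spaces \<open>L\<^sup>p(\<Omega>)\<close>\<close>

lemma Lp_spaceD:
  assumes "u \<in> Lp_space \<Omega> p"
  shows Lp_space_measurable: "u \<in> borel_measurable (lebesgue_on \<Omega>)"
    and Lp_space_integrable: "integrable (lebesgue_on \<Omega>) (\<lambda>x. \<bar>u x\<bar> powr p)"
  using assms by (auto simp: Lp_space_def)

lemma Lp_space_dominated:
  assumes "v \<in> Lp_space \<Omega> p" and u: "u \<in> borel_measurable (lebesgue_on \<Omega>)"
    and le: "\<And>x. \<bar>u x\<bar> \<le> \<bar>v x\<bar>" and p: "0 \<le> p"
  shows "u \<in> Lp_space \<Omega> p"
proof -
  have "integrable (lebesgue_on \<Omega>) (\<lambda>x. \<bar>u x\<bar> powr p)"
  proof (rule Bochner_Integration.integrable_bound[OF Lp_space_integrable[OF assms(1)]])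
    show "(\<lambda>x. \<bar>u x\<bar> powr p) \<in> borel_measurable (lebesgue_on \<Omega>)"
      using u by measurable
    show "AE x in lebesgue_on \<Omega>. norm (\<bar>u x\<bar> powr p) \<le> norm (\<bar>v x\<bar> powr p)"
      using le p by (auto intro!: AE_I2 powr_mono2)
  qed
  then show ?thesis using u by (simp add: Lp_space_def)
qed

lemma Lp_space_cmult:
  assumes "u \<in> Lp_space \<Omega> p"
  shows "(\<lambda>x. c * u x) \<in> Lp_space \<Omega> p"
  using Lp_spaceD[OF assms] by (auto simp: Lp_space_def abs_mult powr_mult)

text \<open>Replacing both arguments by the larger modulus costs a factor \<open>2 powr p\<close>
  and works for every \<open>p\<close> \<ge> 0, also below 1 where Minkowski's inequality
  fails.\<close>

lemma Lp_space_diff: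
  assumes u: "u \<in> Lp_space \<Omega> p" and v: "v \<in> Lp_space \<Omega> p" and p: "0 \<le> p"
  shows "(\<lambda>x. u x - v x) \<in> Lp_space \<Omega> p"
proof -
  have um: "u \<in> borel_measurable (lebesgue_on \<Omega>)" and vm: "v \<in> borel_measurable (lebesgue_on \<Omega>)"
    using u v by (auto dest: Lp_spaceD)
  have le: "\<bar>a - b\<bar> powr p \<le> 2 powr p * (\<bar>a\<bar> powr p + \<bar>b\<bar> powr p)" for a b :: real
  proof -
    have "\<bar>a - b\<bar> powr p \<le> (2 * max \<bar>a\<bar> \<bar>b\<bar>) powr p"
      using p by (intro powr_mono2) auto
    also have "\<dots> = 2 powr p * max \<bar>a\<bar> \<bar>b\<bar> powr p"
      by (simp add: powr_mult)
    also have "\<dots> \<le> 2 powr p * (\<bar>a\<bar> powr p + \<bar>b\<bar> powr p)"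
      by (auto simp: max_def)
    finally show ?thesis .
  qed
  have "integrable (lebesgue_on \<Omega>) (\<lambda>x. \<bar>u x - v x\<bar> powr p)"
  proof (rule Bochner_Integration.integrable_bound)
    show "integrable (lebesgue_on \<Omega>) (\<lambda>x. 2 powr p * (\<bar>u x\<bar> powr p + \<bar>v x\<bar> powr p))"
      using Lp_space_integrable[OF u] Lp_space_integrable[OF v] by auto
    show "(\<lambda>x. \<bar>u x - v x\<bar> powr p) \<in> borel_measurable (lebesgue_on \<Omega>)"
      using um vm by measurable
    show "AE x in lebesgue_on \<Omega>. norm (\<bar>u x - v x\<bar> powr p)
        \<le> norm (2 powr p * (\<bar>u x\<bar> powr p + \<bar>v x\<bar> powr p))"
      using le by (intro AE_I2) (smt (verit, best) norm_powr_real_powr powr_ge_zero real_norm_def)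
  qed
  then show ?thesis using um vm by (simp add: Lp_space_def)
qed

lemma Lp_norm_nonneg: "0 \<le> Lp_norm \<Omega> p u"
  by (simp add: Lp_norm_def)

lemma Lp_norm_powr:
  assumes "0 < p"
  shows "Lp_norm \<Omega> p u powr p = (LINT x|lebesgue_on \<Omega>. \<bar>u x\<bar> powr p)"
  using assms by (simp add: Lp_norm_def powr_powr)

lemma Lp_norm_cmult:
  assumes "0 < p"
  shows "Lp_norm \<Omega> p (\<lambda>x. c * u x) = \<bar>c\<bar> * Lp_norm \<Omega> p u"
  using assms by (simp add: Lp_norm_def abs_mult powr_mult powr_powr)

lemma Lp_norm_eq_0_imp_AE:
  assumes "u \<in> Lp_space \<Omega> p" and "0 < p" and "Lp_norm \<Omega> p u = 0"
  shows "AE x in lebesgue_on \<Omega>. u x = 0"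
proof -
  have "(LINT x|lebesgue_on \<Omega>. \<bar>u x\<bar> powr p) = 0"
    using Lp_norm_powr[OF assms(2), of \<Omega> u] assms(3) by simp
  then have "AE x in lebesgue_on \<Omega>. \<bar>u x\<bar> powr p = 0"
    using integral_nonneg_eq_0_iff_AE[OF Lp_space_integrable[OF assms(1)]] by simp
  then show ?thesis by simp
qed

section \<open>Hoelder's inequality\<close>

text \<open>Young's inequality dominates the product pointwise by integrable powers.\<close>

lemma Lp_integrable_mult:
  assumes f: "f \<in> Lp_space \<Omega> p" and g: "g \<in> Lp_space \<Omega> q"
    and pq: "1 < p" "1 < q" "1 / p + 1 / q = 1"
  shows "integrable (lebesgue_on \<Omega>) (\<lambda>x. f x * g x)"
proof (rule Bochner_Integration.integrable_bound)
  show "integrable (lebesgue_on \<Omega>) (\<lambda>x. \<bar>f x\<bar> powr p / p + \<bar>g x\<bar> powr q / q)"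
    using Lp_space_integrable[OF f] Lp_space_integrable[OF g] by auto
  show "(\<lambda>x. f x * g x) \<in> borel_measurable (lebesgue_on \<Omega>)"
    using f g by (auto dest!: Lp_space_measurable)
  show "AE x in lebesgue_on \<Omega>. norm (f x * g x) \<le> norm (\<bar>f x\<bar> powr p / p + \<bar>g x\<bar> powr q / q)"
  proof (rule AE_I2)
    fix x
    have "\<bar>f x\<bar> * \<bar>g x\<bar> \<le> \<bar>f x\<bar> powr p / p + \<bar>g x\<bar> powr q / q"
      by (rule Youngs_inequality[OF pq]) auto
    then show "norm (f x * g x) \<le> norm (\<bar>f x\<bar> powr p / p + \<bar>g x\<bar> powr q / q)"
      by (simp add: abs_mult)
  qed
qed

text \<open>Young's inequality is applied to the factors divided by their norms and then integrated;
  a factor of norm zero vanishes almost everywhere and is treated first.\<close>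

lemma Lp_Holder:
  assumes f: "f \<in> Lp_space \<Omega> p" and g: "g \<in> Lp_space \<Omega> q"
    and pq: "1 < p" "1 < q" "1 / p + 1 / q = 1"
  shows "(LINT x|lebesgue_on \<Omega>. \<bar>f x * g x\<bar>) \<le> Lp_norm \<Omega> p f * Lp_norm \<Omega> q g"
proof (cases "Lp_norm \<Omega> p f = 0 \<or> Lp_norm \<Omega> q g = 0")
  case True
  then have "AE x in lebesgue_on \<Omega>. f x * g x = 0"
    using Lp_norm_eq_0_imp_AE[OF f] Lp_norm_eq_0_imp_AE[OF g] pq by auto
  then have "(LINT x|lebesgue_on \<Omega>. \<bar>f x * g x\<bar>) = 0"
    by (intro integral_eq_zero_AE) auto
  then show ?thesis by (simp add: Lp_norm_nonneg)
next
  case False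
  define A B where "A = Lp_norm \<Omega> p f" and "B = Lp_norm \<Omega> q g"
  have pos: "0 < A" "0 < B"
    using False Lp_norm_nonneg unfolding A_def B_def by (auto simp: less_le)
  have le: "\<bar>f x * g x\<bar> \<le> A * B * (\<bar>f x\<bar> powr p / A powr p / p + \<bar>g x\<bar> powr q / B powr q / q)" for x
  proof -
    have "(\<bar>f x\<bar> / A) * (\<bar>g x\<bar> / B) \<le> (\<bar>f x\<bar> / A) powr p / p + (\<bar>g x\<bar> / B) powr q / q"
      by (rule Youngs_inequality[OF pq]) (use pos in auto)
    then have "A * B * ((\<bar>f x\<bar> / A) * (\<bar>g x\<bar> / B))
        \<le> A * B * ((\<bar>f x\<bar> / A) powr p / p + (\<bar>g x\<bar> / B) powr q / q)"
      using pos by (intro mult_left_mono) auto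
    moreover have "A * B * ((\<bar>f x\<bar> / A) * (\<bar>g x\<bar> / B)) = \<bar>f x * g x\<bar>"
      using pos by (simp add: abs_mult)
    moreover have "(\<bar>f x\<bar> / A) powr p = \<bar>f x\<bar> powr p / A powr p"
      "(\<bar>g x\<bar> / B) powr q = \<bar>g x\<bar> powr q / B powr q"
      using pos by (simp_all add: powr_divide)
    ultimately show ?thesis by simp
  qed
  have If: "integrable (lebesgue_on \<Omega>) (\<lambda>x. \<bar>f x\<bar> powr p / A powr p / p)"
    and Ig: "integrable (lebesgue_on \<Omega>) (\<lambda>x. \<bar>g x\<bar> powr q / B powr q / q)"
    using Lp_space_integrable[OF f] Lp_space_integrable[OF g] by auto
  have "(LINT x|lebesgue_on \<Omega>. \<bar>f x * g x\<bar>) \<le>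
     (LINT x|lebesgue_on \<Omega>. A * B * (\<bar>f x\<bar> powr p / A powr p / p + \<bar>g x\<bar> powr q / B powr q / q))"
    using If Ig Lp_integrable_mult[OF f g pq] le by (intro integral_mono) auto
  also have "\<dots> = A * B * ((LINT x|lebesgue_on \<Omega>. \<bar>f x\<bar> powr p) / A powr p / p
      + (LINT x|lebesgue_on \<Omega>. \<bar>g x\<bar> powr q) / B powr q / q)"
    using If Ig by simp
  \<comment> \<open>Normalization: \<open>A powr p\<close> and \<open>B powr q\<close> are exactly
    the two integrals.\<close>
  also have "\<dots> = A * B * (1 / p + 1 / q)"
    using pos pq by (simp add: A_def B_def flip: Lp_norm_powr)
  finally show ?thesis using pq by (simp add: A_def B_def)
qed

section \<open>Test functionals and almost everywhere convergence\<close>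

lemma finite_measure_lebesgue_on_finite:
  assumes "\<Omega> \<in> sets lebesgue" and "emeasure lebesgue \<Omega> < \<infinity>"
  shows "finite_measure (lebesgue_on \<Omega>)"
  using assms by (intro finite_measure_lebesgue_on) (simp add: fmeasurable_def)

text \<open>On a finite measure space a bounded \<open>g\<close> lies in the conjugate space, so
  Hoelder's inequality gives the bound. Such functionals are the ones tested against weak
  convergence.\<close>

lemma Lp_dual_integral_bounded:
  assumes fin: "finite_measure (lebesgue_on \<Omega>)"
    and g: "g \<in> borel_measurable (lebesgue_on \<Omega>)" and B: "\<And>x. \<bar>g x\<bar> \<le> B"
    and pq: "1 < p" "1 < q" "1 / p + 1 / q = 1"
  shows "(\<lambda>f. LINT x|lebesgue_on \<Omega>. f x * g x) \<in> Lp_dual \<Omega> p"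
proof -
  have "(\<lambda>x. B) \<in> Lp_space \<Omega> q"
    using finite_measure.integrable_const[OF fin] by (simp add: Lp_space_def)
  then have gL: "g \<in> Lp_space \<Omega> q"
    using g by (rule Lp_space_dominated) (use B pq order_trans[OF B abs_ge_self] in auto)
  show ?thesis
    unfolding Lp_dual_def mem_Collect_eq
  proof (intro conjI ballI allI exI)
    fix f h assume "f \<in> Lp_space \<Omega> p" "h \<in> Lp_space \<Omega> p"
    then show "(LINT x|lebesgue_on \<Omega>. (f x + h x) * g x) =
        (LINT x|lebesgue_on \<Omega>. f x * g x) + (LINT x|lebesgue_on \<Omega>. h x * g x)"
      using Lp_integrable_mult[OF _ gL pq] by (simp add: distrib_right)
  next
    fix c f
    show "(LINT x|lebesgue_on \<Omega>. c * f x * g x) = c * (LINT x|lebesgue_on \<Omega>. f x * g x)"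
      by (simp add: mult.assoc)
  next
    fix f assume "f \<in> Lp_space \<Omega> p"
    then show "\<bar>LINT x|lebesgue_on \<Omega>. f x * g x\<bar> \<le> Lp_norm \<Omega> q g * Lp_norm \<Omega> p f"
      using Lp_Holder[OF _ gL pq] integral_abs_bound[of "lebesgue_on \<Omega>" "\<lambda>x. f x * g x"]
      by (metis (no_types, lifting) mult.commute order_trans)
  qed
qed

text \<open>The powers of the differences tend to 0 in L^1, which yields the subsequence; taking
  roots recovers convergence of the functions.\<close>

lemma Lp_tendsto_AE_subseq:
  assumes "Lp_tendsto \<Omega> p u v" and "\<And>k. u k \<in> Lp_space \<Omega> p" and "v \<in> Lp_space \<Omega> p" and p: "0 < p"
  shows "\<exists>\<rho> :: nat \<Rightarrow> nat. strict_mono \<rho> \<and> (AE x in lebesgue_on \<Omega>. (\<lambda>j. u (\<rho> j) x) \<longlonglongrightarrow> v x)"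
proof -
  have "(\<lambda>k. Lp_norm \<Omega> p (\<lambda>x. u k x - v x) powr p) \<longlonglongrightarrow> 0"
    using assms(1) p by (auto simp: Lp_tendsto_def Lp_norm_nonneg intro!: tendsto_zero_powrI)
  then have "(\<lambda>k. LINT x|lebesgue_on \<Omega>. norm (\<bar>u k x - v x\<bar> powr p)) \<longlonglongrightarrow> 0"
    using p by (simp add: Lp_norm_powr)
  then obtain \<rho> :: "nat \<Rightarrow> nat" where \<rho>: "strict_mono \<rho>"
    and ae: "AE x in lebesgue_on \<Omega>. (\<lambda>j. \<bar>u (\<rho> j) x - v x\<bar> powr p) \<longlonglongrightarrow> 0"
    using tendsto_L1_AE_subseq[of "lebesgue_on \<Omega>" "\<lambda>k x. \<bar>u k x - v x\<bar> powr p"]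
      Lp_space_integrable[OF Lp_space_diff[OF assms(2,3)]] p by auto
  have "(\<lambda>j. u (\<rho> j) x) \<longlonglongrightarrow> v x" if "(\<lambda>j. \<bar>u (\<rho> j) x - v x\<bar> powr p) \<longlonglongrightarrow> 0" for x
  proof -
    have "(\<lambda>j. (\<bar>u (\<rho> j) x - v x\<bar> powr p) powr (1 / p)) \<longlonglongrightarrow> 0"
      using that p by (auto intro!: tendsto_zero_powrI)
    then have "(\<lambda>j. \<bar>u (\<rho> j) x - v x\<bar>) \<longlonglongrightarrow> 0"
      using p by (simp add: powr_powr)
    then show ?thesis by (metis LIM_zero_cancel tendsto_rabs_zero_iff)
  qed
  then show ?thesis using \<rho> ae by auto
qed

section \<open>The Frechet subdifferential\<close>

text \<open>Translates the filter into small balls punctured at norm zero, the form in which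
  subgradients are tested and constructed.\<close>

lemma eventually_Lp_at_zero:
  "eventually P (Lp_at_zero \<Omega> s) \<longleftrightarrow>
    (\<exists>\<delta>>0. \<forall>h\<in>Lp_space \<Omega> s. 0 < Lp_norm \<Omega> s h \<and> Lp_norm \<Omega> s h < \<delta> \<longrightarrow> P h)"
  (is "_ \<longleftrightarrow> ?R")
proof
  assume "eventually P (Lp_at_zero \<Omega> s)"
  then obtain Q where Q: "eventually Q (at_right (0::real))"
    and P: "\<And>h. Q (Lp_norm \<Omega> s h) \<Longrightarrow> h \<in> Lp_space \<Omega> s \<Longrightarrow> P h"
    by (auto simp: Lp_at_zero_def eventually_inf_principal eventually_filtercomap)
  obtain \<delta> where "\<delta> > 0" "\<And>y. y > 0 \<Longrightarrow> y < \<delta> \<Longrightarrow> Q y"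
    using Q by (auto simp: eventually_at_right_field)
  then show ?R using P by auto
next
  assume ?R
  then obtain \<delta> where "\<delta> > 0"
    and P: "\<And>h. h \<in> Lp_space \<Omega> s \<Longrightarrow> 0 < Lp_norm \<Omega> s h \<Longrightarrow> Lp_norm \<Omega> s h < \<delta> \<Longrightarrow> P h"
    by blast
  then have "eventually (\<lambda>y. 0 < y \<and> y < \<delta>) (at_right (0::real))"
    by (auto simp: eventually_at_right_field)
  then show "eventually P (Lp_at_zero \<Omega> s)"
    using P unfolding Lp_at_zero_def eventually_inf_principal eventually_filtercomap by blast
qed

text \<open>A nonnegative lower limit means that the quotient eventually exceeds every negative
  number; as the norm is positive along the filter, the denominator can be cleared.\<close>

lemma frechet_subdiff_q0_iff:
  "\<eta> \<in> frechet_subdiff_q0 \<Omega> s r u \<longleftrightarrow> \<eta> \<in> Lp_space \<Omega> r \<and>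
    (\<forall>\<epsilon>>0. \<exists>\<delta>>0. \<forall>h\<in>Lp_space \<Omega> s. 0 < Lp_norm \<Omega> s h \<and> Lp_norm \<Omega> s h < \<delta> \<longrightarrow>
      - \<epsilon> * Lp_norm \<Omega> s h < q0 \<Omega> (\<lambda>x. u x + h x) - q0 \<Omega> u - (LINT x|lebesgue_on \<Omega>. \<eta> x * h x))"
  (is "_ \<longleftrightarrow> _ \<and> ?R")
proof -
  define f where "f h = (q0 \<Omega> (\<lambda>x. u x + h x) - q0 \<Omega> u - (LINT x|lebesgue_on \<Omega>. \<eta> x * h x))
    / Lp_norm \<Omega> s h" for h
  have "0 \<le> Liminf (Lp_at_zero \<Omega> s) (\<lambda>h. ereal (f h)) \<longleftrightarrow>
      (\<forall>\<epsilon>>0. eventually (\<lambda>h. - \<epsilon> < f h) (Lp_at_zero \<Omega> s))"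
    unfolding le_Liminf_iff
  proof (intro iffI allI impI)
    fix \<epsilon> :: real assume "\<forall>y<0. eventually (\<lambda>h. y < ereal (f h)) (Lp_at_zero \<Omega> s)" "0 < \<epsilon>"
    then have "eventually (\<lambda>h. ereal (- \<epsilon>) < ereal (f h)) (Lp_at_zero \<Omega> s)"
      by (metis ereal_less(2) ereal_less_eq(3) less_ereal.simps(1) neg_less_0_iff_less zero_ereal_def)
    then show "eventually (\<lambda>h. - \<epsilon> < f h) (Lp_at_zero \<Omega> s)" by simp
  next
    fix y :: ereal assume *: "\<forall>\<epsilon>>0. eventually (\<lambda>h. - \<epsilon> < f h) (Lp_at_zero \<Omega> s)" and "y < 0"
    then show "eventually (\<lambda>h. y < ereal (f h)) (Lp_at_zero \<Omega> s)"
    proof (cases y)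
      case (real z)
      then show ?thesis using *[rule_format, of "- z"] \<open>y < 0\<close> by simp
    qed auto
  qed
  also have "\<dots> \<longleftrightarrow> ?R"
  proof -
    have "(0 < Lp_norm \<Omega> s h \<and> Lp_norm \<Omega> s h < \<delta> \<longrightarrow> - \<epsilon> < f h) \<longleftrightarrow>
      (0 < Lp_norm \<Omega> s h \<and> Lp_norm \<Omega> s h < \<delta> \<longrightarrow> - \<epsilon> * Lp_norm \<Omega> s h
        < q0 \<Omega> (\<lambda>x. u x + h x) - q0 \<Omega> u - (LINT x|lebesgue_on \<Omega>. \<eta> x * h x))" for \<epsilon> \<delta> h
      by (auto simp: f_def less_divide_eq)
    then show ?thesis unfolding eventually_Lp_at_zero by simp
  qed
  finally show ?thesis by (simp add: frechet_subdiff_q0_def f_def)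
qed

text \<open>Perturbing \<open>u\<close> by small multiples of \<open>\<bar>u\<bar> sgn \<eta>\<close> does not change its support, so that only
  the linear term contributes.\<close>

lemma frechet_subdiff_q0_support:
  assumes u: "u \<in> Lp_space \<Omega> s" and \<eta>: "\<eta> \<in> frechet_subdiff_q0 \<Omega> s r u"
    and sr: "1 < s" "1 < r" "1 / s + 1 / r = 1"
  shows "AE x in lebesgue_on \<Omega>. u x \<noteq> 0 \<longrightarrow> \<eta> x = 0"
proof -
  have \<eta>L: "\<eta> \<in> Lp_space \<Omega> r" using \<eta> by (simp add: frechet_subdiff_q0_def)
  have um: "u \<in> borel_measurable (lebesgue_on \<Omega>)" and \<eta>m: "\<eta> \<in> borel_measurable (lebesgue_on \<Omega>)"
    using u \<eta>L by (auto dest: Lp_spaceD)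
  \<comment> \<open>The factor \<open>\<bar>u x\<bar>\<close> puts \<open>w\<close> into L^s and
    makes the perturbation relative to \<open>u\<close>; the sign makes
    \<open>\<eta> x * w x\<close> nonnegative.\<close>
  define w where "w x = \<bar>u x\<bar> * sgn (\<eta> x)" for x
  have wL: "w \<in> Lp_space \<Omega> s"
    using u
  proof (rule Lp_space_dominated)
    show "w \<in> borel_measurable (lebesgue_on \<Omega>)"
      unfolding w_def using um \<eta>m by measurable
  qed (use sr in \<open>auto simp: w_def abs_mult sgn_if\<close>)
  define J where "J = (LINT x|lebesgue_on \<Omega>. \<bar>w x * \<eta> x\<bar>)"
  have w\<eta>: "\<eta> x * w x = \<bar>w x * \<eta> x\<bar>" "\<bar>w x * \<eta> x\<bar> = \<bar>u x\<bar> * \<bar>\<eta> x\<bar>" for x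
    by (auto simp: w_def abs_mult sgn_if)
  have "J = 0"
  proof (rule ccontr)
    assume "J \<noteq> 0"
    moreover have "0 \<le> J"
      unfolding J_def by (rule integral_nonneg_AE) simp
    ultimately have J: "0 < J" by simp
    define N where "N = Lp_norm \<Omega> s w"
    have N: "0 < N"
    proof -
      have "N \<noteq> 0"
        using Lp_Holder[OF wL \<eta>L sr] J by (auto simp: J_def N_def)
      then show ?thesis using Lp_norm_nonneg[of \<Omega> s w] by (simp add: N_def)
    qed
    \<comment> \<open>Along small positive multiples of \<open>w\<close> the difference quotient is
      exactly \<open>- (J / N)\<close>, so the strict inequality with \<epsilon> =
      \<open>J / N\<close> must fail.\<close>
    obtain \<delta> where \<delta>: "\<delta> > 0" and *: "\<And>h. h \<in> Lp_space \<Omega> s \<Longrightarrow> 0 < Lp_norm \<Omega> s h \<Longrightarrow>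
      Lp_norm \<Omega> s h < \<delta> \<Longrightarrow> - (J / N) * Lp_norm \<Omega> s h
        < q0 \<Omega> (\<lambda>x. u x + h x) - q0 \<Omega> u - (LINT x|lebesgue_on \<Omega>. \<eta> x * h x)"
      using \<eta>[unfolded frechet_subdiff_q0_iff, THEN conjunct2, rule_format, OF divide_pos_pos[OF J N]]
      by blast
    \<comment> \<open>The bound 1/2 keeps the support of \<open>u\<close> unchanged; the other bound
      brings the norm of the perturbation below \<delta>.\<close>
    define \<tau> where "\<tau> = min (1/2) (\<delta> / (2 * N))"
    have \<tau>: "0 < \<tau>" "\<tau> < 1" using \<delta> N by (auto simp: \<tau>_def)
    have norm: "Lp_norm \<Omega> s (\<lambda>x. \<tau> * w x) = \<tau> * N"
      using \<tau> sr by (simp add: Lp_norm_cmult N_def)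
    have "\<tau> * N \<le> \<delta> / 2"
      using N mult_right_mono[of \<tau> "\<delta> / (2 * N)" N] by (simp add: \<tau>_def)
    then have "- (J / N) * (\<tau> * N)
        < q0 \<Omega> (\<lambda>x. u x + \<tau> * w x) - q0 \<Omega> u - (LINT x|lebesgue_on \<Omega>. \<eta> x * (\<tau> * w x))"
      using *[OF Lp_space_cmult[OF wL, of \<tau>]] \<tau> N \<delta> unfolding norm by simp
    moreover have "u x + \<tau> * w x = 0 \<longleftrightarrow> u x = 0" for x
    proof -
      have "u x + \<tau> * w x = u x * (1 + \<tau> * (sgn (u x) * sgn (\<eta> x)))"
        unfolding w_def abs_sgn[of "u x"] by (simp add: algebra_simps)
      moreover have "1 + \<tau> * (sgn (u x) * sgn (\<eta> x)) \<noteq> 0"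
        using \<tau> by (auto simp: sgn_if)
      ultimately show ?thesis by simp
    qed
    then have "q0 \<Omega> (\<lambda>x. u x + \<tau> * w x) = q0 \<Omega> u"
      by (simp add: q0_def abs0_def)
    moreover have "(LINT x|lebesgue_on \<Omega>. \<eta> x * (\<tau> * w x)) = \<tau> * J"
      unfolding J_def w\<eta>(1)[symmetric] by (simp add: mult.left_commute)
    \<comment> \<open>Both sides of the strict inequality equal
      \<open>- (\<tau> * J)\<close>.\<close>
    ultimately show False using N by simp
  qed
  moreover have "integrable (lebesgue_on \<Omega>) (\<lambda>x. \<bar>w x * \<eta> x\<bar>)"
    using Lp_integrable_mult[OF wL \<eta>L sr] by auto
  ultimately have "AE x in lebesgue_on \<Omega>. \<bar>w x * \<eta> x\<bar> = 0"
    unfolding J_def by (subst (asm) integral_nonneg_eq_0_iff_AE) auto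
  then show ?thesis unfolding w\<eta>(2) by auto
qed

section \<open>Construction of Frechet subgradients\<close>

text \<open>Dominated convergence: at each point the tail is zero once \<open>n\<close> reaches
  \<open>\<bar>\<eta> x\<bar>\<close>.\<close>

lemma Lp_norm_tail_tendsto_0:
  assumes \<eta>: "\<eta> \<in> Lp_space \<Omega> p" and p: "0 < p"
  shows "(\<lambda>n. Lp_norm \<Omega> p (\<lambda>x. if \<bar>\<eta> x\<bar> > real n then \<eta> x else 0)) \<longlonglongrightarrow> 0"
proof -
  note [measurable] = Lp_space_measurable[OF \<eta>]
  have "(\<lambda>n. LINT x|lebesgue_on \<Omega>. \<bar>if \<bar>\<eta> x\<bar> > real n then \<eta> x else 0\<bar> powr p)
    \<longlonglongrightarrow> (LINT x|lebesgue_on \<Omega>. 0)"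
  proof (rule integral_dominated_convergence)
    show "integrable (lebesgue_on \<Omega>) (\<lambda>x. \<bar>\<eta> x\<bar> powr p)"
      using \<eta> by (rule Lp_space_integrable)
    show "AE x in lebesgue_on \<Omega>. (\<lambda>n. \<bar>if \<bar>\<eta> x\<bar> > real n then \<eta> x else 0\<bar> powr p) \<longlonglongrightarrow> 0"
    proof (rule AE_I2, rule tendsto_eventually)
      fix x
      obtain m :: nat where "\<bar>\<eta> x\<bar> \<le> real m" using real_arch_simple by blast
      then show "\<forall>\<^sub>F n in sequentially. \<bar>if \<bar>\<eta> x\<bar> > real n then \<eta> x else 0\<bar> powr p = 0"
        by (intro eventually_sequentiallyI[of m]) auto
    qed
    show "AE x in lebesgue_on \<Omega>. norm (\<bar>if \<bar>\<eta> x\<bar> > real n then \<eta> x else 0\<bar> powr p) \<le> \<bar>\<eta> x\<bar> powr p" for n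
      by (intro AE_I2) auto
  qed measurable
  then show ?thesis
    using p unfolding Lp_norm_def
    by (intro tendsto_zero_powrI[where b = "1 / p"] tendsto_const) auto
qed

text \<open>The part of \<open>\<eta>\<close> above the level \<open>M\<close> has small norm, and where \<open>\<bar>\<eta>\<bar> \<le> M\<close> the linear term
  \<open>\<eta> h\<close> exceeds the jump of \<open>q\<^bsub>s,0\<^esub>\<close> only if \<open>\<bar>h\<bar> > 1 / M\<close>. There, as well as where \<open>h\<close> cancels
  \<open>u\<close>, the integrand is bounded by a multiple of \<open>\<bar>h\<bar>\<^sup>s\<close>, which is of higher order since \<open>s > 1\<close>.\<close>

lemma frechet_subdiff_q0_I:
  assumes fin: "finite_measure (lebesgue_on \<Omega>)"
    and u: "u \<in> borel_measurable (lebesgue_on \<Omega>)"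
    and c: "0 < c" "\<And>x. u x \<noteq> 0 \<Longrightarrow> c \<le> \<bar>u x\<bar>"
    and \<eta>: "\<eta> \<in> Lp_space \<Omega> r" and supp: "AE x in lebesgue_on \<Omega>. \<eta> x \<noteq> 0 \<longrightarrow> u x = 0"
    and sr: "1 < s" "1 < r" "1 / s + 1 / r = 1"
  shows "\<eta> \<in> frechet_subdiff_q0 \<Omega> s r u"
  unfolding frechet_subdiff_q0_iff
proof (intro conjI \<eta> allI impI)
  fix \<epsilon> :: real assume \<epsilon>: "0 < \<epsilon>"
  note [measurable] = u Lp_space_measurable[OF \<eta>]
  have rs: "1 / r + 1 / s = 1" using sr by simp
  have "\<forall>\<^sub>F n in sequentially. Lp_norm \<Omega> r (\<lambda>x. if \<bar>\<eta> x\<bar> > real n then \<eta> x else 0) < \<epsilon> / 2"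
    using Lp_norm_tail_tendsto_0[OF \<eta>] sr \<epsilon> by (intro order_tendstoD(2)) auto
  then obtain M where M: "Lp_norm \<Omega> r (\<lambda>x. if \<bar>\<eta> x\<bar> > real M then \<eta> x else 0) < \<epsilon> / 2"
    by (auto simp: eventually_sequentially)
  define \<zeta> where "\<zeta> x = (if \<bar>\<eta> x\<bar> > real M then \<eta> x else 0)" for x
  have \<zeta>m[measurable]: "\<zeta> \<in> borel_measurable (lebesgue_on \<Omega>)" unfolding \<zeta>_def by measurable
  have \<zeta>: "\<zeta> \<in> Lp_space \<Omega> r"
    using \<eta> \<zeta>m by (rule Lp_space_dominated) (use sr in \<open>auto simp: \<zeta>_def\<close>)
  \<comment> \<open>The first summand pays for large \<open>h\<close> on \<open>{u = 0}\<close>, the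
    second for points where \<open>h\<close> cancels \<open>u\<close>.\<close>
  define K where "K = real M powr s + (1 / c) powr s"
  have K: "0 < K" using c by (auto simp: K_def add_nonneg_pos)
  \<comment> \<open>Solves \<open>K * \<delta> powr (s - 1) = \<epsilon> / 2\<close>; the tail
    \<zeta> takes the other half of \<epsilon>.\<close>
  define \<delta> where "\<delta> = (\<epsilon> / (2 * K)) powr (1 / (s - 1))"
  have pointwise: "- (\<bar>\<zeta> x * h\<bar> + K * \<bar>h\<bar> powr s) \<le> abs0 (u x + h) - abs0 (u x) - \<eta> x * h"
    if x: "\<eta> x \<noteq> 0 \<longrightarrow> u x = 0" for x h
  proof (cases "u x = 0")
    case True
    have "\<eta> x * h \<le> abs0 h + \<bar>\<zeta> x * h\<bar> + real M powr s * \<bar>h\<bar> powr s"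
    \<comment> \<open>Either \<zeta> agrees with \<eta> at \<open>x\<close>, or the jump
      \<open>abs0 h\<close> pays for the product. Otherwise 1 < \<open>\<eta> x * h\<close> \<le>
      \<open>real M * \<bar>h\<bar>\<close>, and raising a number above 1 to the power
      \<open>s\<close> increases it.\<close>
    proof (cases "\<bar>\<eta> x\<bar> > real M \<or> \<eta> x * h \<le> 1")
      case True
      then have "\<eta> x * h \<le> abs0 h + \<bar>\<zeta> x * h\<bar>"
      proof
        assume "real M < \<bar>\<eta> x\<bar>"
        then show ?thesis
          using abs_ge_self[of "\<eta> x * h"] by (simp add: \<zeta>_def abs0_def)
      next
        assume "\<eta> x * h \<le> 1"
        moreover have "0 \<le> \<bar>\<zeta> x * h\<bar>" by simp
        ultimately show ?thesis unfolding abs0_def by (cases "h = 0") auto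
      qed
      then show ?thesis by (simp add: add_increasing2)
    next
      case False
      have "\<eta> x * h \<le> real M * \<bar>h\<bar>"
        using False abs_ge_self[of "\<eta> x * h"] mult_right_mono[of "\<bar>\<eta> x\<bar>" "real M" "\<bar>h\<bar>"]
        by (auto simp: abs_mult)
      moreover have "real M * \<bar>h\<bar> \<le> (real M * \<bar>h\<bar>) powr s"
        using calculation False powr_mono[of 1 s "real M * \<bar>h\<bar>"] sr by simp
      moreover have "(real M * \<bar>h\<bar>) powr s = real M powr s * \<bar>h\<bar> powr s"
        by (simp add: powr_mult)
      ultimately show ?thesis by (smt (verit) abs0_def)
    qed
    moreover have "real M powr s * \<bar>h\<bar> powr s \<le> K * \<bar>h\<bar> powr s"
      by (intro mult_right_mono) (auto simp: K_def)
    ultimately show ?thesis using True by (simp add: abs0_def)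
  next
    case False
    then have \<eta>0: "\<eta> x = 0" using x by auto
    show ?thesis
    proof (cases "u x + h = 0")
      case True
      \<comment> \<open>Cancellation forces \<open>\<bar>h\<bar> = \<bar>u x\<bar>\<close>, which is
        at least \<open>c\<close>.\<close>
      then have "1 \<le> (1 / c) * \<bar>h\<bar>"
        using c False by (smt (verit) le_divide_eq_1_pos mult_cancel_right1 times_divide_eq_left)
      then have "1 \<le> ((1 / c) * \<bar>h\<bar>) powr s"
        using sr by (simp add: ge_one_powr_ge_zero)
      also have "\<dots> = (1 / c) powr s * \<bar>h\<bar> powr s"
        using c by (subst powr_mult) auto
      also have "\<dots> \<le> K * \<bar>h\<bar> powr s"
        by (intro mult_right_mono) (auto simp: K_def)
      finally show ?thesis using True False \<eta>0 by (simp add: abs0_def)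
    next
      case nz: False
      have "0 \<le> K * \<bar>h\<bar> powr s" using K by auto
      then show ?thesis using nz False \<eta>0 by (simp add: abs0_def \<zeta>_def)
    qed
  qed
  show "\<exists>\<delta>>0. \<forall>h\<in>Lp_space \<Omega> s. 0 < Lp_norm \<Omega> s h \<and> Lp_norm \<Omega> s h < \<delta> \<longrightarrow>
      - \<epsilon> * Lp_norm \<Omega> s h < q0 \<Omega> (\<lambda>x. u x + h x) - q0 \<Omega> u - (LINT x|lebesgue_on \<Omega>. \<eta> x * h x)"
  proof (intro exI conjI ballI impI)
    show "0 < \<delta>" using \<epsilon> K by (simp add: \<delta>_def)
    fix h assume h: "h \<in> Lp_space \<Omega> s" and "0 < Lp_norm \<Omega> s h \<and> Lp_norm \<Omega> s h < \<delta>"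
    then have n: "0 < Lp_norm \<Omega> s h" "Lp_norm \<Omega> s h < \<delta>" by auto
    note [measurable] = Lp_space_measurable[OF h]
    have abs0_int: "integrable (lebesgue_on \<Omega>) (\<lambda>x. abs0 (v x))"
      if [measurable]: "v \<in> borel_measurable (lebesgue_on \<Omega>)" for v
      by (rule finite_measure.integrable_const_bound[OF fin, of _ 1]) (auto simp: abs0_def)
    have int: "integrable (lebesgue_on \<Omega>) (\<lambda>x. abs0 (u x + h x))"
      "integrable (lebesgue_on \<Omega>) (\<lambda>x. abs0 (u x))"
      "integrable (lebesgue_on \<Omega>) (\<lambda>x. \<eta> x * h x)"
      "integrable (lebesgue_on \<Omega>) (\<lambda>x. \<bar>\<zeta> x * h x\<bar>)"
      "integrable (lebesgue_on \<Omega>) (\<lambda>x. \<bar>h x\<bar> powr s)"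
      using Lp_integrable_mult[OF \<eta> h sr(2,1) rs] Lp_integrable_mult[OF \<zeta> h sr(2,1) rs]
        Lp_space_integrable[OF h] by (auto intro!: abs0_int)
    have "(LINT x|lebesgue_on \<Omega>. - (\<bar>\<zeta> x * h x\<bar> + K * \<bar>h x\<bar> powr s)) \<le>
        (LINT x|lebesgue_on \<Omega>. abs0 (u x + h x) - abs0 (u x) - \<eta> x * h x)"
      using int supp pointwise by (intro integral_mono_AE) auto
    also have "\<dots> = q0 \<Omega> (\<lambda>x. u x + h x) - q0 \<Omega> u - (LINT x|lebesgue_on \<Omega>. \<eta> x * h x)"
      using int by (simp add: q0_def)
    also have "(LINT x|lebesgue_on \<Omega>. - (\<bar>\<zeta> x * h x\<bar> + K * \<bar>h x\<bar> powr s)) =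
        - ((LINT x|lebesgue_on \<Omega>. \<bar>\<zeta> x * h x\<bar>) + K * Lp_norm \<Omega> s h powr s)"
      using int sr by (simp add: Lp_norm_powr)
    finally have lower: "- ((LINT x|lebesgue_on \<Omega>. \<bar>\<zeta> x * h x\<bar>) + K * Lp_norm \<Omega> s h powr s)
      \<le> q0 \<Omega> (\<lambda>x. u x + h x) - q0 \<Omega> u - (LINT x|lebesgue_on \<Omega>. \<eta> x * h x)" .
    have "(LINT x|lebesgue_on \<Omega>. \<bar>\<zeta> x * h x\<bar>) \<le> Lp_norm \<Omega> r \<zeta> * Lp_norm \<Omega> s h"
      by (rule Lp_Holder[OF \<zeta> h sr(2,1) rs])
    also have "\<dots> < \<epsilon> / 2 * Lp_norm \<Omega> s h"
      using M n by (intro mult_strict_right_mono) (auto simp: \<zeta>_def[abs_def])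
    finally have 1: "(LINT x|lebesgue_on \<Omega>. \<bar>\<zeta> x * h x\<bar>) < \<epsilon> / 2 * Lp_norm \<Omega> s h" .
    have "Lp_norm \<Omega> s h powr (s - 1) \<le> \<delta> powr (s - 1)"
      using n sr by (intro powr_mono2) auto
    also have "\<dots> = \<epsilon> / (2 * K)"
      using sr \<epsilon> K by (simp add: \<delta>_def powr_powr)
    finally have "K * (Lp_norm \<Omega> s h powr (s - 1) * Lp_norm \<Omega> s h)
        \<le> K * (\<epsilon> / (2 * K) * Lp_norm \<Omega> s h)"
      using K n by (intro mult_left_mono mult_right_mono) auto
    moreover have "Lp_norm \<Omega> s h powr (s - 1) * Lp_norm \<Omega> s h = Lp_norm \<Omega> s h powr s"
      using n powr_add[of "Lp_norm \<Omega> s h" "s - 1" 1] by simp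
    ultimately have 2: "K * Lp_norm \<Omega> s h powr s \<le> \<epsilon> / 2 * Lp_norm \<Omega> s h"
      using K by simp
    show "- \<epsilon> * Lp_norm \<Omega> s h < q0 \<Omega> (\<lambda>x. u x + h x) - q0 \<Omega> u - (LINT x|lebesgue_on \<Omega>. \<eta> x * h x)"
      using lower 1 2 by simp
  qed
qed

section \<open>The singular subdifferential\<close>

lemma singular_subdiff_q0_support:
  assumes fin: "finite_measure (lebesgue_on \<Omega>)"
    and sr: "1 < s" "1 < r" "1 / s + 1 / r = 1"
    and ubar: "ubar \<in> Lp_space \<Omega> s"
    and \<eta>: "\<eta> \<in> singular_subdiff_q0 \<Omega> s r ubar"
  shows "AE x in lebesgue_on \<Omega>. \<eta> x \<noteq> 0 \<longrightarrow> ubar x = 0"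
proof -
  obtain u t \<xi> where \<eta>L: "\<eta> \<in> Lp_space \<Omega> r" and u: "\<And>k. u k \<in> Lp_space \<Omega> s"
    and lim: "Lp_tendsto \<Omega> s u ubar" and weak: "Lp_weak_tendsto \<Omega> r (\<lambda>k x. t k * \<xi> k x) \<eta>"
    and \<xi>: "\<And>k. \<xi> k \<in> frechet_subdiff_q0 \<Omega> s r (u k)"
    using \<eta> by (auto simp: singular_subdiff_q0_def)
  have rs: "1 / r + 1 / s = 1" using sr by simp
  note [measurable] = Lp_space_measurable[OF \<eta>L] Lp_space_measurable[OF u]
  obtain \<rho> where \<rho>: "strict_mono \<rho>"
    and ae: "AE x in lebesgue_on \<Omega>. (\<lambda>j. u (\<rho> j) x) \<longlonglongrightarrow> ubar x"
    using Lp_tendsto_AE_subseq[OF lim u ubar] sr by auto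
  \<comment> \<open>The set depends on \<open>n\<close> only, so one fixed functional serves for all
    late indices \<open>j\<close>; the sign turns \<open>\<eta> x * g n x\<close> into
    \<open>\<bar>\<eta> x\<bar>\<close> there.\<close>
  define g where "g n x = (if \<forall>j\<ge>n. u (\<rho> j) x \<noteq> 0 then sgn (\<eta> x) else 0)" for n x
  have g[measurable]: "g n \<in> borel_measurable (lebesgue_on \<Omega>)" for n
    unfolding g_def by measurable
  have "AE x in lebesgue_on \<Omega>. (\<forall>j\<ge>n. u (\<rho> j) x \<noteq> 0) \<longrightarrow> \<eta> x = 0" for n
  proof -
    let ?\<phi> = "\<lambda>f. LINT x|lebesgue_on \<Omega>. f x * g n x"
    have "?\<phi> \<in> Lp_dual \<Omega> r"
      by (rule Lp_dual_integral_bounded[OF fin g _ sr(2,1) rs, of _ 1]) (auto simp: g_def sgn_if)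
    then have "(\<lambda>k. ?\<phi> (\<lambda>x. t k * \<xi> k x)) \<longlonglongrightarrow> ?\<phi> \<eta>"
      by (rule bspec[OF weak[unfolded Lp_weak_tendsto_def]])
    then have "(\<lambda>j. ?\<phi> (\<lambda>x. t (\<rho> j) * \<xi> (\<rho> j) x)) \<longlonglongrightarrow> ?\<phi> \<eta>"
      using LIMSEQ_subseq_LIMSEQ[OF _ \<rho>] by (fastforce simp: o_def)
    \<comment> \<open>The subgradient vanishes almost everywhere on
      \<open>{u (\<rho> j) \<noteq> 0}\<close>, which contains the support of
      \<open>g n\<close>.\<close>
    moreover have "?\<phi> (\<lambda>x. t (\<rho> j) * \<xi> (\<rho> j) x) = 0" if "n \<le> j" for j
    proof (rule integral_eq_zero_AE)
      show "AE x in lebesgue_on \<Omega>. t (\<rho> j) * \<xi> (\<rho> j) x * g n x = 0"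
        using frechet_subdiff_q0_support[OF u \<xi> sr, of "\<rho> j"]
        by eventually_elim (use that in \<open>auto simp: g_def\<close>)
    qed
    then have "(\<lambda>j. ?\<phi> (\<lambda>x. t (\<rho> j) * \<xi> (\<rho> j) x)) \<longlonglongrightarrow> 0"
      by (intro tendsto_eventually eventually_sequentiallyI)
    ultimately have "?\<phi> \<eta> = 0" by (rule LIMSEQ_unique)
    moreover have "(\<lambda>x. 1) \<in> Lp_space \<Omega> s"
      using finite_measure.integrable_const[OF fin] by (simp add: Lp_space_def)
    then have "g n \<in> Lp_space \<Omega> s"
      using g by (rule Lp_space_dominated) (use sr in \<open>auto simp: g_def sgn_if\<close>)
    then have "integrable (lebesgue_on \<Omega>) (\<lambda>x. \<eta> x * g n x)"
      using Lp_integrable_mult[OF \<eta>L _ sr(2,1) rs] by auto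
    ultimately have "AE x in lebesgue_on \<Omega>. \<eta> x * g n x = 0"
      by (subst (asm) integral_nonneg_eq_0_iff_AE) (auto simp: g_def sgn_if)
    then show ?thesis by eventually_elim (auto simp: g_def sgn_if split: if_splits)
  qed
  \<comment> \<open>The exceptional null sets, one for each \<open>n\<close>, have a null
    union.\<close>
  then have "AE x in lebesgue_on \<Omega>. \<forall>n. (\<forall>j\<ge>n. u (\<rho> j) x \<noteq> 0) \<longrightarrow> \<eta> x = 0"
    unfolding AE_all_countable by blast
  with ae show ?thesis
  proof eventually_elim
    case (elim x)
    show ?case
    proof (rule impI, rule ccontr)
      assume "\<eta> x \<noteq> 0" "ubar x \<noteq> 0"
      then have "\<forall>\<^sub>F j in sequentially. u (\<rho> j) x \<noteq> 0"
        by (intro tendsto_imp_eventually_ne[OF elim(1)])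
      then show False using elim \<open>\<eta> x \<noteq> 0\<close> by (auto simp: eventually_sequentially)
    qed
  qed
qed

lemma singular_subdiff_q0_I:
  assumes fin: "finite_measure (lebesgue_on \<Omega>)"
    and sr: "1 < s" "1 < r" "1 / s + 1 / r = 1"
    and ubar: "ubar \<in> Lp_space \<Omega> s"
    and \<eta>: "\<eta> \<in> Lp_space \<Omega> r" and supp: "AE x in lebesgue_on \<Omega>. \<eta> x \<noteq> 0 \<longrightarrow> ubar x = 0"
  shows "\<eta> \<in> singular_subdiff_q0 \<Omega> s r ubar"
proof -
  note [measurable] = Lp_space_measurable[OF \<eta>] Lp_space_measurable[OF ubar]
  \<comment> \<open>The cutoff makes every nonzero value at least \<open>1 / real (Suc k)\<close> in
    modulus, the gap required for building subgradients. \<open>Suc\<close> keeps the threshold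
    positive at index 0.\<close>
  define u where "u k x = (if \<bar>ubar x\<bar> \<ge> 1 / real (Suc k) then ubar x else 0)" for k x
  define t where "t k = 1 / real (Suc k)" for k
  define \<xi> where "\<xi> k x = real (Suc k) * \<eta> x" for k x
  have um[measurable]: "u k \<in> borel_measurable (lebesgue_on \<Omega>)" for k
    unfolding u_def by measurable
  have uL: "u k \<in> Lp_space \<Omega> s" for k
    using ubar um by (rule Lp_space_dominated) (use sr in \<open>auto simp: u_def\<close>)
  have \<xi>L: "\<xi> k \<in> Lp_space \<Omega> r" for k
    using Lp_space_cmult[OF \<eta>, of "real (Suc k)"] unfolding \<xi>_def .
  have t\<xi>: "(\<lambda>x. t k * \<xi> k x) = \<eta>" for k
    by (simp add: t_def \<xi>_def)
  \<comment> \<open>Eventual equality, not mere convergence, is what passes through the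
    discontinuity of \<open>abs0\<close> at 0.\<close>
  have ev: "\<forall>\<^sub>F k in sequentially. u k x = ubar x" for x
  proof (cases "ubar x = 0")
    case False
    then obtain m where m: "1 / real (Suc m) < \<bar>ubar x\<bar>"
      using nat_approx_posE[of "\<bar>ubar x\<bar>"] by auto
    have "1 / real (Suc k) \<le> 1 / real (Suc m)" if "m \<le> k" for k
      using that by (intro divide_left_mono) auto
    then show ?thesis using m
      by (intro eventually_sequentiallyI[of m]) (force simp: u_def)
  qed (simp add: u_def)
  have "(\<lambda>k. LINT x|lebesgue_on \<Omega>. \<bar>u k x - ubar x\<bar> powr s) \<longlonglongrightarrow> (LINT x|lebesgue_on \<Omega>. 0)"
  proof (rule integral_dominated_convergence)
    show "integrable (lebesgue_on \<Omega>) (\<lambda>x. \<bar>ubar x\<bar> powr s)"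
      using ubar by (rule Lp_space_integrable)
    show "AE x in lebesgue_on \<Omega>. (\<lambda>k. \<bar>u k x - ubar x\<bar> powr s) \<longlonglongrightarrow> 0"
      by (intro AE_I2 tendsto_eventually eventually_mono[OF ev]) auto
    \<comment> \<open>The difference is either 0 or \<open>- ubar x\<close>.\<close>
    show "AE x in lebesgue_on \<Omega>. norm (\<bar>u k x - ubar x\<bar> powr s) \<le> \<bar>ubar x\<bar> powr s" for k
      by (intro AE_I2) (auto simp: u_def)
  qed measurable
  then have lim: "Lp_tendsto \<Omega> s u ubar"
    using sr unfolding Lp_tendsto_def Lp_norm_def
    by (intro tendsto_zero_powrI[where b = "1 / s"] tendsto_const) auto
  have q: "(\<lambda>k. q0 \<Omega> (u k)) \<longlonglongrightarrow> q0 \<Omega> ubar"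
    unfolding q0_def
  proof (rule integral_dominated_convergence)
    show "integrable (lebesgue_on \<Omega>) (\<lambda>x. 1 :: real)"
      by (rule finite_measure.integrable_const[OF fin])
    show "AE x in lebesgue_on \<Omega>. (\<lambda>k. abs0 (u k x)) \<longlonglongrightarrow> abs0 (ubar x)"
    proof (rule AE_I2, rule tendsto_eventually)
      show "\<forall>\<^sub>F k in sequentially. abs0 (u k x) = abs0 (ubar x)" for x
        using ev[of x] by eventually_elim simp
    qed
  qed (auto simp: abs0_def)
  have "\<xi> k \<in> frechet_subdiff_q0 \<Omega> s r (u k)" for k
  proof (rule frechet_subdiff_q0_I[OF fin um _ _ \<xi>L _ sr])
    show "0 < 1 / real (Suc k)" by simp
    show "u k x \<noteq> 0 \<Longrightarrow> 1 / real (Suc k) \<le> \<bar>u k x\<bar>" for x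
      by (auto simp: u_def split: if_splits)
    \<comment> \<open>Scaling keeps the support of \<eta>, and truncation only enlarges the zero set
      of \<open>ubar\<close>.\<close>
    show "AE x in lebesgue_on \<Omega>. \<xi> k x \<noteq> 0 \<longrightarrow> u k x = 0"
      using supp by eventually_elim (auto simp: \<xi>_def u_def)
  qed
  moreover have "t \<longlonglongrightarrow> 0"
    unfolding t_def by (rule LIMSEQ_Suc[OF lim_1_over_n])
  moreover have "Lp_weak_tendsto \<Omega> r (\<lambda>k x. t k * \<xi> k x) \<eta>"
    by (simp add: Lp_weak_tendsto_def t\<xi>)
  moreover have "0 < t k" for k by (simp add: t_def)
  ultimately show ?thesis
    using \<eta> uL \<xi>L lim q unfolding singular_subdiff_q0_def by blast
qed

theorem theorem3p8:
  fixes \<Omega> :: "(real ^ 'd) set" and s r :: real and ubar :: "real ^ 'd \<Rightarrow> real"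
  assumes "\<Omega> \<in> sets lebesgue" and "0 < emeasure lebesgue \<Omega>" and "emeasure lebesgue \<Omega> < \<infinity>"
    and "1 < s" and "1 < r" and "1 / s + 1 / r = 1"
    and "ubar \<in> Lp_space \<Omega> s"
  shows "singular_subdiff_q0 \<Omega> s r ubar =
    {\<eta> \<in> Lp_space \<Omega> r. AE x in lebesgue_on \<Omega>. \<eta> x \<noteq> 0 \<longrightarrow> ubar x = 0}"
proof -
  have fin: "finite_measure (lebesgue_on \<Omega>)"
    using assms(1,3) by (rule finite_measure_lebesgue_on_finite)
  show ?thesis
    using singular_subdiff_q0_support[OF fin assms(4-7)] singular_subdiff_q0_I[OF fin assms(4-7)]
    by (auto simp: singular_subdiff_q0_def)
qed

end
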